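(* Let $\mathbf{a}=(a_1,a_2,\ldots,a_k)\in\mathbb{Z}_{\geq 1}^k$ be a composition of $n$ with $k$ parts. Then there exists a flattened Fubini ranking with runs of ascents whose reduced content is $\mathbf{a}$ if and only if $a_i\leq i$ for all $1\leq i\leq k$.
   Context: Let $[n]=\{1,2,\ldots,n\}$. A Fubini ranking of length $n$ is a tuple $r=(r_1,\ldots,r_n)\in[n]^n$ that records a valid ranking of $n$ competitors with ties allowed, where if exactly $k$ competitors are tied at rank $i$, then the next $k-1$ ranks $i+1,\ldots,i+k-1$ are disallowed; equivalently, $r_i=1+|\{j : r_j<r_i\}|$ for every $i\in[n]$. The content of a Fubini ranking of length $n$ is the tuple $(c_1,\ldots,c_n)$ where $c_i$ is the number of entries equal to $i$; the reduced content is obtained from the content by deleting all entries equal to $0$. A run of ascents of a word $w=w_1\cdots w_n$ is a maximal contiguous subword $w_iw_{i+1}\cdots w_j$ with $w_l<w_{l+1}$ for all $i\le l\le j-1$. A Fubini ranking is flattened with runs of ascents if the leading (first) terms of its runs of ascents, read from left to right, are in strictly increasing order. A composition of $n$ is a tuple of positive integers with sum $n$. *)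

theory Defs
  imports Main
begin

text \<open>
  Words and tuples are lists of natural numbers. List positions start at 0, so the
  \<open>i\<close>-th entry of a tuple \<open>w\<close> is \<^term>\<open>w ! (i - 1)\<close>.
\<close>

definition composition :: "nat \<Rightarrow> nat \<Rightarrow> nat list \<Rightarrow> bool" where
  "composition n k a \<longleftrightarrow> length a = k \<and> (\<forall>x\<in>set a. 1 \<le> x) \<and> sum_list a = n"

definition fubini_ranking :: "nat \<Rightarrow> nat list \<Rightarrow> bool" where
  "fubini_ranking n r \<longleftrightarrow>
     length r = n \<and> set r \<subseteq> {1..n} \<and>
     (\<forall>i<n. r ! i = 1 + card {j. j < n \<and> r ! j < r ! i})"

definition content :: "nat list \<Rightarrow> nat list" where
  "content r = map (\<lambda>i. count_list r i) [1..<Suc (length r)]"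

definition reduced_content :: "nat list \<Rightarrow> nat list" where
  "reduced_content r = filter (\<lambda>c. c \<noteq> 0) (content r)"

definition ascending_factor :: "nat list \<Rightarrow> nat \<Rightarrow> nat \<Rightarrow> bool" where
  "ascending_factor w i j \<longleftrightarrow>
     i \<le> j \<and> j < length w \<and> (\<forall>l. i \<le> l \<and> l < j \<longrightarrow> w ! l < w ! Suc l)"

text \<open>A contiguous subword is represented by the positions of its first and last letters.\<close>

definition ascent_run :: "nat list \<Rightarrow> nat \<Rightarrow> nat \<Rightarrow> bool" where
  "ascent_run w i j \<longleftrightarrow>
     ascending_factor w i j \<and>
     (\<forall>i' j'. i' \<le> i \<and> j \<le> j' \<and> ascending_factor w i' j' \<longrightarrow> i' = i \<and> j' = j)"

text \<open>Distinct runs start at distinct positions, so each run contributes exactly one term.\<close>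

definition leading_terms :: "nat list \<Rightarrow> nat list" where
  "leading_terms w = map (\<lambda>i. w ! i) (filter (\<lambda>i. \<exists>j. ascent_run w i j) [0..<length w])"

definition flattened_ascents :: "nat list \<Rightarrow> bool" where
  "flattened_ascents w \<longleftrightarrow> sorted_wrt (<) (leading_terms w)"

end

theory Submission
  imports Defs
begin

text \<open>
  The leading terms of a word are its first letter together with every letter that does not
  exceed its predecessor. Both directions rest on this description.

  For necessity, every occurrence of a value \<open>v\<close> lies in a run whose leading term is at most
  \<open>v\<close>, and a run, being strictly increasing, contains \<open>v\<close> at most once. So \<open>v\<close> occurs at most
  as often as there are leading terms \<open>\<le> v\<close> (\<open>count_le_leading_terms\<close>). In a flattened word
  the leading terms are pairwise distinct, so if \<open>v\<close> is the \<open>i\<close>-th smallest value that occurs,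
  there are at most \<open>i\<close> of them.

  For sufficiency, the composition already determines which values a ranking must use: the
  \<open>i\<close>-th smallest is one plus the sum of the first \<open>i - 1\<close> parts. Any word with
  these values and the prescribed multiplicities is a Fubini ranking, whatever the order of its
  letters (\<open>ranking_of_multiplicities\<close>). It remains to order them so that the word is flattened.
  Form one strictly increasing block \<open>B\<^sub>j\<close> for each value, beginning with the \<open>j\<close>-th smallest
  value, and give the remaining \<open>a\<^sub>i - 1\<close> copies of the \<open>i\<close>-th value to the blocks just before
  \<open>B\<^sub>i\<close>; there are enough of those exactly because \<open>a\<^sub>i \<le> i\<close>. The blocks are concatenated in
  order. A run can start only where a block starts, so the leading terms form a subsequence of
  the increasing sequence of block heads (\<open>flattened_concat_blocks\<close>).
\<close>

section \<open>Leading terms by recursion on the word\<close>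

text \<open>
  Starting at a position without an ascent into it, the longest ascending factor is maximal on
  both sides, since it cannot be extended to the left.
\<close>

lemma ascent_run_start_iff:
  "(\<exists>j. ascent_run w i j) \<longleftrightarrow> i < length w \<and> (i = 0 \<or> \<not> w ! (i - 1) < w ! i)"
proof
  assume "\<exists>j. ascent_run w i j"
  then obtain j where run: "ascent_run w i j" ..
  then have fac: "ascending_factor w i j"
    and mx: "\<And>i'. i' \<le> i \<Longrightarrow> ascending_factor w i' j \<Longrightarrow> i' = i"
    unfolding ascent_run_def by blast+
  have "\<not> w ! (i - 1) < w ! i" if "i \<noteq> 0"
  proof
    assume asc: "w ! (i - 1) < w ! i"
    have "ascending_factor w (i - 1) j"
      unfolding ascending_factor_def
    proof (intro conjI allI impI)
      fix l assume l: "i - 1 \<le> l \<and> l < j"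
      show "w ! l < w ! Suc l"
      proof (cases "l = i - 1")
        case True
        then show ?thesis using asc that by simp
      next
        case False
        with l have "i \<le> l" by linarith
        then show ?thesis using l fac unfolding ascending_factor_def by simp
      qed
    qed (use fac in \<open>auto simp: ascending_factor_def\<close>)
    with mx[of "i - 1"] that show False by simp
  qed
  then show "i < length w \<and> (i = 0 \<or> \<not> w ! (i - 1) < w ! i)"
    using fac unfolding ascending_factor_def by auto
next
  assume start: "i < length w \<and> (i = 0 \<or> \<not> w ! (i - 1) < w ! i)"
  define j where "j = (GREATEST j. ascending_factor w i j)"
  have ex: "ascending_factor w i i"
    using start unfolding ascending_factor_def by simp
  have bound: "\<And>j. ascending_factor w i j \<Longrightarrow> j \<le> length w"
    unfolding ascending_factor_def by simp
  have fac: "ascending_factor w i j"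
    unfolding j_def using GreatestI_nat[where P = "ascending_factor w i", OF ex bound] .
  have mx: "j' \<le> j" if "ascending_factor w i j'" for j'
    unfolding j_def using Greatest_le_nat[where P = "ascending_factor w i", OF that bound] .
  have "i' = i \<and> j' = j"
    if h: "i' \<le> i" "j \<le> j'" "ascending_factor w i' j'" for i' j'
  proof -
    have "i' = i"
    proof (rule ccontr)
      assume "i' \<noteq> i"
      with h(1) have "i' \<le> i - 1" "i \<noteq> 0" by auto
      moreover have "i \<le> j" using fac unfolding ascending_factor_def by simp
      ultimately have "w ! (i - 1) < w ! Suc (i - 1)"
        using h unfolding ascending_factor_def by auto
      with start \<open>i \<noteq> 0\<close> show False by simp
    qed
    with mx h show ?thesis by (simp add: order.antisym)
  qed
  with fac show "\<exists>j. ascent_run w i j" unfolding ascent_run_def by blast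
qed

text \<open>
  The letter in front of the word is carried as a separate argument, because whether a letter
  starts a run depends only on its predecessor. This lets proofs about leading terms proceed by
  structural induction, without reference to positions.
\<close>

fun weak_descent_bottoms :: "nat \<Rightarrow> nat list \<Rightarrow> nat list" where
  "weak_descent_bottoms x [] = []"
| "weak_descent_bottoms x (y # w) =
     (if x < y then weak_descent_bottoms y w else y # weak_descent_bottoms y w)"

lemma weak_descent_bottoms_conv_nth:
  "weak_descent_bottoms x w =
     map (\<lambda>i. w ! i) (filter (\<lambda>i. \<not> (x # w) ! i < w ! i) [0..<length w])"
proof (induction w arbitrary: x)
  case (Cons y w)
  have "[0..<length (y # w)] = 0 # map Suc [0..<length w]"
    by (simp add: upt_conv_Cons map_Suc_upt del: upt_Suc)
  then show ?case
    by (simp add: Cons.IH filter_map comp_def del: upt_Suc)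
qed simp

lemma leading_terms_Nil: "leading_terms [] = []"
  by (simp add: leading_terms_def)

lemma leading_terms_Cons: "leading_terms (x # w) = x # weak_descent_bottoms x w"
proof -
  have "[0..<length (x # w)] = 0 # map Suc [0..<length w]"
    by (simp add: upt_conv_Cons map_Suc_upt del: upt_Suc)
  moreover have "leading_terms (x # w) = map ((!) (x # w))
      (filter (\<lambda>i. i = 0 \<or> \<not> (x # w) ! (i - 1) < (x # w) ! i) [0..<length (x # w)])"
    unfolding leading_terms_def ascent_run_start_iff
    by (rule arg_cong[where f = "map ((!) (x # w))"], rule filter_cong) auto
  ultimately show ?thesis
    by (simp add: weak_descent_bottoms_conv_nth filter_map comp_def del: upt_Suc)
qed

lemma set_weak_descent_bottoms: "set (weak_descent_bottoms x w) \<subseteq> set w"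
  by (induction x w rule: weak_descent_bottoms.induct) auto

lemma set_leading_terms: "set (leading_terms w) \<subseteq> set w"
  using set_weak_descent_bottoms
  by (cases w) (fastforce simp: leading_terms_Nil leading_terms_Cons)+

section \<open>The bound on the multiplicities\<close>

text \<open>
  Each occurrence of \<open>v\<close> is charged to the leading term of its run, and no leading term is
  charged twice. In the induction on the tail, prepending \<open>x\<close> with \<open>x < y\<close> replaces the leading
  term \<open>y\<close> by the smaller \<open>x\<close>. This cannot lower the right-hand side, and if \<open>x = v\<close>, then
  \<open>y\<close> did not contribute to it while \<open>x\<close> does, which pays for the new occurrence.
\<close>

lemma count_le_leading_terms:
  "count_list w v \<le> length (filter (\<lambda>x. x \<le> v) (leading_terms w))"
proof (cases w)
  case (Cons x u)
  have "count_list (x # u) v \<le> length (filter (\<lambda>x. x \<le> v) (x # weak_descent_bottoms x u))"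
  proof (induction u arbitrary: x)
    case (Cons y u)
    show ?case using Cons.IH[of y] by (auto split: if_splits)
  qed simp
  then show ?thesis by (simp only: Cons leading_terms_Cons)
qed simp

lemma flattened_count_le_card:
  assumes "flattened_ascents w"
  shows "count_list w v \<le> card {x \<in> set w. x \<le> v}"
proof -
  have dist: "distinct (leading_terms w)"
    using assms strict_sorted_iff unfolding flattened_ascents_def by blast
  have "count_list w v \<le> length (filter (\<lambda>x. x \<le> v) (leading_terms w))"
    by (rule count_le_leading_terms)
  also have "\<dots> = card {x \<in> set (leading_terms w). x \<le> v}"
    using dist by (metis distinct_card distinct_filter set_filter)
  also have "\<dots> \<le> card {x \<in> set w. x \<le> v}"
    using set_leading_terms by (intro card_mono) auto
  finally show ?thesis .
qed

lemma reduced_content_conv_map: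
  "reduced_content r =
     map (count_list r) (filter (\<lambda>x. x \<in> set r) [1..<Suc (length r)])"
proof -
  have "(0 < count_list r x) = (x \<in> set r)" for x
    by (metis count_list_0_iff gr0I less_numeral_extra(3))
  then show ?thesis
    by (simp add: reduced_content_def content_def filter_map comp_def del: upt_Suc)
qed

text \<open>
  The entry at position \<open>i\<close> of the reduced content is the multiplicity of the value with exactly
  \<open>i\<close> smaller values in the word, so at most \<open>Suc i\<close> values can serve as leading terms of the
  runs that contain it.
\<close>

lemma flattened_reduced_content_le:
  assumes flat: "flattened_ascents r" and rng: "set r \<subseteq> {1..length r}"
    and i: "i < length (reduced_content r)"
  shows "reduced_content r ! i \<le> Suc i"
proof -
  define vs where "vs = filter (\<lambda>x. x \<in> set r) [1..<Suc (length r)]"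
  have set_vs: "set vs = set r"
    using rng unfolding vs_def by auto
  have srt: "sorted_wrt (<) vs"
    unfolding vs_def by (intro sorted_wrt_filter sorted_wrt_upt)
  have i': "i < length vs" and nth: "reduced_content r ! i = count_list r (vs ! i)"
    using i unfolding reduced_content_conv_map vs_def by simp_all
  have "{x \<in> set r. x \<le> vs ! i} \<subseteq> (\<lambda>j. vs ! j) ` {..i}"
  proof
    fix x assume x: "x \<in> {x \<in> set r. x \<le> vs ! i}"
    then obtain j where j: "j < length vs" "x = vs ! j"
      by (auto simp: in_set_conv_nth simp flip: set_vs)
    have "j \<le> i"
    proof (rule ccontr)
      assume "\<not> j \<le> i"
      with srt j have "vs ! i < vs ! j" by (simp add: sorted_wrt_iff_nth_less)
      with x j show False by simp
    qed
    with j show "x \<in> (\<lambda>j. vs ! j) ` {..i}" by auto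
  qed
  then have "card {x \<in> set r. x \<le> vs ! i} \<le> card {..i}"
    by (rule surj_card_le[rotated]) simp
  then show ?thesis
    using flattened_count_le_card[OF flat, of "vs ! i"] nth by simp
qed

section \<open>Words made of increasing blocks\<close>

text \<open>An increasing block produces no leading term after its head, so only its last letter
  influences what follows.\<close>

lemma weak_descent_bottoms_block:
  "sorted_wrt (<) (x # ys) \<Longrightarrow>
     weak_descent_bottoms x (ys @ u) = weak_descent_bottoms (last (x # ys)) u"
  by (induction ys arbitrary: x) auto

text \<open>
  The blocks need not be the runs: where the last letter of a block is smaller than the next
  head, the two blocks merge. Merging only deletes a head from the list of leading terms, and
  what remains is still increasing.
\<close>

lemma flattened_concat_blocks:
  assumes "\<And>b. b \<in> set bs \<Longrightarrow> b \<noteq> [] \<and> sorted_wrt (<) b"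
    and "sorted_wrt (<) (map hd bs)"
  shows "flattened_ascents (concat bs)"
  using assms unfolding flattened_ascents_def
proof (induction bs)
  case (Cons b bs)
  obtain x ys where b: "b = x # ys"
    using Cons.prems(1)[of b] by (cases b) auto
  have srt: "sorted_wrt (<) (x # ys)"
    using Cons.prems(1)[of b] b by simp
  have IH: "sorted_wrt (<) (leading_terms (concat bs))"
    using Cons.prems by (intro Cons.IH) auto
  show ?case
  proof (cases bs)
    case Nil
    then show ?thesis
      using weak_descent_bottoms_block[OF srt, of "[]"] b by (simp add: leading_terms_Cons)
  next
    case (Cons c cs)
    obtain y zs where c: "c = y # zs"
      using Cons.prems(1)[of c] Cons by (cases c) auto
    have "x < y"
      using Cons.prems(2) b c Cons by simp
    then show ?thesis
      using IH b c Cons weak_descent_bottoms_block[OF srt, of "concat bs"]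
      by (auto simp: leading_terms_Cons)
  qed
qed (simp add: leading_terms_Nil)

section \<open>Rankings with prescribed multiplicities\<close>

text \<open>
  The rank shared by the competitors of the tie group with index \<open>i\<close>, counted from \<open>0\<close>, when
  \<open>a\<close> lists the group sizes. The value at \<open>i = length a\<close> is the first rank past the end.
\<close>

definition rank_value :: "nat list \<Rightarrow> nat \<Rightarrow> nat" where
  "rank_value a i = Suc (sum_list (take i a))"

lemma rank_value_less:
  assumes pos: "\<forall>x\<in>set a. 1 \<le> x" and "i < j" "j \<le> length a"
  shows "rank_value a i < rank_value a j"
  using assms(2,3)
proof (induction j)
  case (Suc j)
  have "rank_value a j < rank_value a (Suc j)"
    using pos[rule_format, of "a ! j"] Suc.prems(2)
    by (simp add: rank_value_def take_Suc_conv_app_nth)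
  then show ?case using Suc by (cases "i = j") auto
qed simp

text \<open>
  Being a Fubini ranking and having a given content depend only on the multiset of entries. The
  entries below \<open>rank_value a i\<close> are those of the first \<open>i\<close> groups, and their number is exactly
  what the definition of \<open>rank_value\<close> adds to one.
\<close>

lemma ranking_of_multiplicities:
  assumes comp: "composition n k a"
    and sub: "set r \<subseteq> rank_value a ` {..<k}"
    and cnt: "\<And>i. i < k \<Longrightarrow> count_list r (rank_value a i) = a ! i"
  shows "fubini_ranking n r" and "reduced_content r = a"
proof -
  let ?v = "rank_value a"
  have len: "length a = k" and pos: "\<forall>x\<in>set a. 1 \<le> x" and sum: "sum_list a = n"
    using comp unfolding composition_def by auto
  have v_less: "?v i < ?v j" if "i < j" "j \<le> k" for i j
    using rank_value_less[OF pos] that len by simp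
  have v_less_iff: "?v i < ?v j \<longleftrightarrow> i < j" if "i \<le> k" "j \<le> k" for i j
    using v_less[of i j] v_less[of j i] that by (cases i j rule: linorder_cases) auto
  have below: "length (filter (\<lambda>x. x < ?v i) r) = sum_list (take i a)" if i: "i \<le> k" for i
  proof -
    let ?f = "filter (\<lambda>x. x < ?v i) r"
    have inj: "inj_on ?v {..<i}"
      by (rule linorder_inj_onI') (use v_less i in force)
    have "set ?f \<subseteq> ?v ` {..<i}"
      using sub i v_less_iff by fastforce
    then have "length ?f = (\<Sum>x\<in>?v ` {..<i}. count_list ?f x)"
      by (subst sum_count_set) auto
    also have "\<dots> = (\<Sum>j<i. count_list ?f (?v j))"
      by (simp add: sum.reindex[OF inj])
    also have "\<dots> = (\<Sum>j<i. a ! j)"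
    proof (rule sum.cong)
      fix j assume "j \<in> {..<i}"
      then have j: "j < i" by simp
      have "count_list ?f (?v j) = count_list r (?v j)"
        unfolding count_list_eq_length_filter filter_filter
        by (rule arg_cong[where f = length], rule filter_cong) (use v_less j i in auto)
      with cnt j i show "count_list ?f (?v j) = a ! j" by simp
    qed simp
    also have "\<dots> = sum_list (take i a)"
      using i len by (simp add: sum_list_sum_nth atLeast0LessThan min_absorb2)
    finally show ?thesis .
  qed
  have v_k: "?v k = Suc n"
    using len sum by (simp add: rank_value_def)
  have rng: "set r \<subseteq> {1..n}"
  proof
    fix x assume "x \<in> set r"
    then obtain i where "i < k" "x = ?v i" using sub by auto
    then show "x \<in> {1..n}" using v_less[of i k] v_k by (auto simp: rank_value_def)
  qed
  \<comment> \<open>Every entry is below the rank past the end, so the count at \<open>k\<close> gives the length.\<close>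
  have "filter (\<lambda>x. x < ?v k) r = r"
    using rng v_k by (auto simp: filter_id_conv)
  then have len_r: "length r = n"
    using below[of k] len sum by simp
  show "fubini_ranking n r"
    unfolding fubini_ranking_def
  proof (intro conjI allI impI len_r rng)
    fix p assume "p < n"
    then obtain i where i: "i < k" "r ! p = ?v i"
      using sub len_r nth_mem[of p r] by blast
    have "card {j. j < n \<and> r ! j < r ! p} = length (filter (\<lambda>x. x < ?v i) r)"
      by (simp add: length_filter_conv_card len_r i)
    with below[of i] i show "r ! p = 1 + card {j. j < n \<and> r ! j < r ! p}"
      by (simp add: rank_value_def)
  qed
  have mem: "?v i \<in> set r" if "i < k" for i
    using cnt[OF that] pos len that nth_mem[of i a]
    by (metis count_notin not_one_le_zero)
  have "filter (\<lambda>x. x \<in> set r) [1..<Suc (length r)] = map ?v [0..<k]"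
  proof (rule strict_sorted_equal)
    show "sorted_wrt (<) (filter (\<lambda>x. x \<in> set r) [1..<Suc (length r)])"
      by (intro sorted_wrt_filter sorted_wrt_upt)
    show "sorted_wrt (<) (map ?v [0..<k])"
      by (simp add: sorted_wrt_iff_nth_less v_less)
    show "set (filter (\<lambda>x. x \<in> set r) [1..<Suc (length r)]) = set (map ?v [0..<k])"
      using rng len_r sub mem by (force simp del: upt_Suc)
  qed
  then show "reduced_content r = a"
    unfolding reduced_content_conv_map
    using cnt len by (auto intro!: nth_equalityI)
qed

lemma count_list_concat: "count_list (concat xss) x = (\<Sum>xs\<leftarrow>xss. count_list xs x)"
  by (induction xss) auto

lemma count_list_distinct: "distinct xs \<Longrightarrow> count_list xs x = (if x \<in> set xs then 1 else 0)"
  by (induction xs) auto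

text \<open>
  With indices from \<open>0\<close>, the value of index \<open>i\<close> is put into the blocks
  \<open>Suc i - a ! i, \<dots>, i\<close>. The bound on \<open>a ! i\<close> says that this interval does not start below \<open>0\<close>,
  so it has \<open>a ! i\<close> elements; positivity of the parts says that it contains \<open>i\<close>, so block \<open>j\<close>
  begins with the value of index \<open>j\<close>.
\<close>

lemma ex_flattened_ranking:
  assumes comp: "composition n k a"
    and bnd: "\<And>i. i < k \<Longrightarrow> a ! i \<le> Suc i"
  shows "\<exists>r. fubini_ranking n r \<and> flattened_ascents r \<and> reduced_content r = a"
proof -
  let ?v = "rank_value a"
  define B where "B j = map ?v (filter (\<lambda>i. i < j + a ! i) [j..<k])" for j
  define r where "r = concat (map B [0..<k])"
  have len: "length a = k" and pos: "\<forall>x\<in>set a. 1 \<le> x"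
    using comp unfolding composition_def by auto
  have v_less: "?v i < ?v j" if "i < j" "j \<le> k" for i j
    using rank_value_less[OF pos] that len by simp
  have inj: "inj_on ?v {..<k}"
    by (rule linorder_inj_onI') (use v_less in force)
  have a_pos: "0 < a ! j" if "j < k" for j
    using pos len that nth_mem[of j a] by fastforce
  have hd_B: "B j \<noteq> [] \<and> hd (B j) = ?v j" if "j < k" for j
    using a_pos[OF that] that unfolding B_def by (simp add: upt_conv_Cons)
  have sorted_B: "sorted_wrt (<) (B j)" for j
  proof -
    have "sorted_wrt (<) (filter (\<lambda>i. i < j + a ! i) [j..<k])"
      by (intro sorted_wrt_filter sorted_wrt_upt)
    then show ?thesis
      unfolding B_def sorted_wrt_map
      by (rule sorted_wrt_mono_rel[rotated]) (auto intro: v_less)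
  qed
  have "flattened_ascents r"
    unfolding r_def
  proof (rule flattened_concat_blocks)
    show "sorted_wrt (<) (map hd (map B [0..<k]))"
      by (simp add: sorted_wrt_iff_nth_less hd_B v_less)
  qed (use hd_B sorted_B in auto)
  moreover have "set r \<subseteq> ?v ` {..<k}"
    unfolding r_def B_def by auto
  moreover have "count_list r (?v i) = a ! i" if i: "i < k" for i
  proof -
    have "count_list (B j) (?v i) = (if j \<le> i \<and> i < j + a ! i then 1 else 0)" for j
    proof -
      have "distinct (B j)"
        using sorted_B strict_sorted_iff by blast
      moreover have "?v i \<in> set (B j) \<longleftrightarrow> j \<le> i \<and> i < j + a ! i"
        using i inj unfolding B_def by (auto simp: inj_on_def)
      ultimately show ?thesis
        by (simp add: count_list_distinct)
    qed
    then have "count_list r (?v i) = (\<Sum>j<k. if j \<le> i \<and> i < j + a ! i then 1 else 0)"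
      unfolding r_def
      by (simp add: count_list_concat comp_def interv_sum_list_conv_sum_set_nat
          atLeast0LessThan)
    also have "\<dots> = card {j \<in> {..<k}. j \<le> i \<and> i < j + a ! i}"
      by (simp add: sum.If_cases Int_def)
    also have "{j \<in> {..<k}. j \<le> i \<and> i < j + a ! i} = {Suc i - a ! i..<Suc i}"
      using i bnd[OF i] by auto
    also have "card \<dots> = a ! i"
      using bnd[OF i] by simp
    finally show ?thesis .
  qed
  ultimately show ?thesis
    using ranking_of_multiplicities[OF comp] by blast
qed

theorem theorem4p2:
  fixes a :: "nat list" and n k :: nat
  assumes "composition n k a"
  shows "(\<exists>r. fubini_ranking n r \<and> flattened_ascents r \<and> reduced_content r = a) \<longleftrightarrow>
         (\<forall>i. 1 \<le> i \<and> i \<le> k \<longrightarrow> a ! (i - 1) \<le> i)"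
proof
  assume "\<exists>r. fubini_ranking n r \<and> flattened_ascents r \<and> reduced_content r = a"
  then obtain r where r: "fubini_ranking n r" "flattened_ascents r" "reduced_content r = a"
    by blast
  show "\<forall>i. 1 \<le> i \<and> i \<le> k \<longrightarrow> a ! (i - 1) \<le> i"
  proof (intro allI impI)
    fix i assume i: "1 \<le> i \<and> i \<le> k"
    have "reduced_content r ! (i - 1) \<le> Suc (i - 1)"
      using r assms i
      by (intro flattened_reduced_content_le) (auto simp: fubini_ranking_def composition_def)
    with r i show "a ! (i - 1) \<le> i" by simp
  qed
next
  assume bnd: "\<forall>i. 1 \<le> i \<and> i \<le> k \<longrightarrow> a ! (i - 1) \<le> i"
  have "a ! i \<le> Suc i" if "i < k" for i
    using bnd[rule_format, of "Suc i"] that by simp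
  then show "\<exists>r. fubini_ranking n r \<and> flattened_ascents r \<and> reduced_content r = a"
    using ex_flattened_ranking[OF assms] by blast
qed

end
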